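(* Let $f,c:\mathbb{R}^n\to\mathbb{R}$ be locally Lipschitz continuous, let $\emptyset\neq X\subseteq\mathbb{R}^n$ be convex and closed, let $\rho\ge 0$, and let $H$ be the associated improvement function. Let $\mathcal{M}=\min_{a\in A(\cdot)}\mathcal{M}_a$ be a model for $H$ satisfying the model requirements (stated in the context). If $\bar x$ is a local solution to the problem $$\min_{x\in X} f(x)\quad\text{s.t.}\quad c(x)\le 0,$$ then $\bar x$ is FM-critical; that is, $\bar x\in X$, $c(\bar x)\le 0$, and $\bar x\in\arg\min_{x\in X}\mathcal{M}_a(x;\bar x)$ for every $a\in A(\bar x)$ with $\mathcal{M}_a(\bar x;\bar x)=H(\bar x;\bar x)$.
   Context: Improvement function: for a given parameter $\rho\ge0$, $H(y;x)=\max\{f(y)-\tau_f(x),\,c(y)\}$ with $\tau_f(x)=f(x)+\rho\max\{c(x),0\}$. Model requirements: for every $x\in X$, $A(x)$ is a finite (nonempty) index set, and for every $a\in A(x)$ the function $\mathcal{M}_a(\cdot;x):\mathbb{R}^n\to\mathbb{R}$ is real-valued and convex. One sets $\mathcal{M}(\cdot;x):=\min_{a\in A(x)}\mathcal{M}_a(\cdot;x)$ and requires: (a) $\mathcal{M}(x;x)=H(x;x)$ for all $x\in X$; (b) there exists a constant $\bar\mu\in[0,+\infty)$ such that $H(y;x)\le\mathcal{M}(y;x)+\frac{\bar\mu}{2}\|y-x\|^2$ for all $x,y\in X$. Criticality: let $A_H(\bar x):=\{a\in A(\bar x):\mathcal{M}_a(\bar x;\bar x)=H(\bar x;\bar x)\}$.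 A point $\bar x\in X$ is M-critical if $\bar x\in\arg\min_{x\in X}\mathcal{M}_a(x;\bar x)$ for all $a\in A_H(\bar x)$. It is FM-critical if it is M-critical and $c(\bar x)\le0$. A local solution is a feasible point ($\bar x\in X$, $c(\bar x)\le0$) minimizing $f$ over the feasible points in some neighbourhood of $\bar x$. $\|\cdot\|$ is the Euclidean norm. *)

theory Defs
  imports "HOL-Analysis.Analysis"
begin

text \<open>Throughout, binary functions such as \<open>H\<close> and \<open>M a\<close> take their arguments in the
  order of the notation \<open>H(y; x)\<close>: first the running point \<open>y\<close>, then the reference point \<open>x\<close>.\<close>

text \<open>The library's \<open>local_lipschitz\<close> is about time-dependent families of functions.\<close>

definition locally_lipschitz :: "('a::metric_space \<Rightarrow> 'b::metric_space) \<Rightarrow> bool" where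
  "locally_lipschitz g \<longleftrightarrow> (\<forall>x. \<exists>r>0. \<exists>L. L-lipschitz_on (ball x r) g)"

definition tau :: "('v \<Rightarrow> real) \<Rightarrow> ('v \<Rightarrow> real) \<Rightarrow> real \<Rightarrow> 'v \<Rightarrow> real" where
  "tau f c \<rho> x = f x + \<rho> * max (c x) 0"

definition improvement_function ::
    "('v \<Rightarrow> real) \<Rightarrow> ('v \<Rightarrow> real) \<Rightarrow> real \<Rightarrow> 'v \<Rightarrow> 'v \<Rightarrow> real" where
  "improvement_function f c \<rho> y x = max (f y - tau f c \<rho> x) (c y)"

definition min_model :: "('v \<Rightarrow> 'i set) \<Rightarrow> ('i \<Rightarrow> 'v \<Rightarrow> 'v \<Rightarrow> real) \<Rightarrow> 'v \<Rightarrow> 'v \<Rightarrow> real" where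
  "min_model A M y x = Min ((\<lambda>a. M a y x) ` A x)"

definition is_model ::
    "'v::real_normed_vector set \<Rightarrow> ('v \<Rightarrow> 'v \<Rightarrow> real) \<Rightarrow> ('v \<Rightarrow> 'i set) \<Rightarrow> ('i \<Rightarrow> 'v \<Rightarrow> 'v \<Rightarrow> real) \<Rightarrow> bool" where
  "is_model X H A M \<longleftrightarrow>
     (\<forall>x\<in>X. finite (A x) \<and> A x \<noteq> {}) \<and>
     (\<forall>x\<in>X. \<forall>a\<in>A x. convex_on UNIV (\<lambda>y. M a y x)) \<and>
     (\<forall>x\<in>X. min_model A M x x = H x x) \<and>
     (\<exists>\<mu>\<ge>0. \<forall>x\<in>X. \<forall>y\<in>X. H y x \<le> min_model A M y x + \<mu> / 2 * (norm (y - x))\<^sup>2)"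

definition active_indices ::
    "('v \<Rightarrow> 'v \<Rightarrow> real) \<Rightarrow> ('v \<Rightarrow> 'i set) \<Rightarrow> ('i \<Rightarrow> 'v \<Rightarrow> 'v \<Rightarrow> real) \<Rightarrow> 'v \<Rightarrow> 'i set" where
  "active_indices H A M x = {a \<in> A x. M a x x = H x x}"

definition M_critical ::
    "'v set \<Rightarrow> ('v \<Rightarrow> 'v \<Rightarrow> real) \<Rightarrow> ('v \<Rightarrow> 'i set) \<Rightarrow> ('i \<Rightarrow> 'v \<Rightarrow> 'v \<Rightarrow> real) \<Rightarrow> 'v \<Rightarrow> bool" where
  "M_critical X H A M x \<longleftrightarrow>
     x \<in> X \<and> (\<forall>a\<in>active_indices H A M x. is_arg_min (\<lambda>y. M a y x) (\<lambda>y. y \<in> X) x)"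

definition FM_critical ::
    "'v set \<Rightarrow> ('v \<Rightarrow> real) \<Rightarrow> ('v \<Rightarrow> 'v \<Rightarrow> real) \<Rightarrow> ('v \<Rightarrow> 'i set) \<Rightarrow> ('i \<Rightarrow> 'v \<Rightarrow> 'v \<Rightarrow> real) \<Rightarrow> 'v \<Rightarrow> bool" where
  "FM_critical X c H A M x \<longleftrightarrow> M_critical X H A M x \<and> c x \<le> 0"

definition local_solution ::
    "'v::topological_space set \<Rightarrow> ('v \<Rightarrow> real) \<Rightarrow> ('v \<Rightarrow> real) \<Rightarrow> 'v \<Rightarrow> bool" where
  "local_solution X f c x \<longleftrightarrow>
     (\<exists>U. open U \<and> x \<in> U \<and> is_arg_min f (\<lambda>y. y \<in> X \<and> c y \<le> 0 \<and> y \<in> U) x)"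

end

theory Submission
  imports Defs
begin

text \<open>At a local solution \<open>x\<close> the improvement function vanishes and is nonnegative on \<open>X\<close> near
  \<open>x\<close>, since an infeasible point has \<open>c > 0\<close> and a feasible one has \<open>f \<ge> f x\<close>. Hence each
  active convex piece of the model is locally minimized at \<open>x\<close> up to a quadratic error. Moving
  along a segment towards a competitor, convexity gives a linear decrease, which the quadratic
  error cannot compensate near \<open>x\<close>.\<close>

lemma convex_on_minimum_if_local_up_to_quadratic:
  fixes g :: "'a::real_normed_vector \<Rightarrow> real"
  assumes conv: "convex_on X g" and "x \<in> X" and "z \<in> X" and "open U" and "x \<in> U"
    and local: "\<And>y. y \<in> X \<Longrightarrow> y \<in> U \<Longrightarrow> g x \<le> g y + k * (norm (y - x))\<^sup>2"
  shows "g x \<le> g z"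
proof -
  define y where "y t = (1 - t) *\<^sub>R x + t *\<^sub>R z" for t :: real
  have "(y \<longlongrightarrow> (1 - 0) *\<^sub>R x + 0 *\<^sub>R z) (at_right 0)"
    unfolding y_def by (intro tendsto_intros)
  then have "\<forall>\<^sub>F t in at_right 0. y t \<in> U"
    using \<open>open U\<close> \<open>x \<in> U\<close> by (simp add: tendsto_def)
  \<comment> \<open>\<open>t < 1\<close> keeps \<open>y t\<close> on the segment from
    \<open>x\<close> to \<open>z\<close>, and \<open>0 < t\<close> permits the division by
    \<open>t\<close> below.\<close>
  moreover have "\<forall>\<^sub>F t::real in at_right 0. 0 < t \<and> t < 1"
    using eventually_at_right_real[of 0 "1::real"] by simp
  ultimately have ev: "\<forall>\<^sub>F t in at_right 0. g x - g z \<le> t * (k * (norm (z - x))\<^sup>2)"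
  proof eventually_elim
    case (elim t)
    have "y t \<in> X"
      using convexD_alt[OF convex_on_imp_convex[OF conv] \<open>x \<in> X\<close> \<open>z \<in> X\<close>] elim(2)
      by (simp add: y_def)
    moreover have "y t - x = t *\<^sub>R (z - x)"
      by (simp add: y_def algebra_simps)
    ultimately have "g x \<le> g (y t) + k * (t * norm (z - x))\<^sup>2"
      using local[of "y t"] elim by simp
    moreover have "g (y t) \<le> (1 - t) * g x + t * g z"
      unfolding y_def using convex_onD[OF conv] elim(2) \<open>x \<in> X\<close> \<open>z \<in> X\<close> by simp
    \<comment> \<open>Once \<open>g x\<close> cancels, the gap \<open>g x - g z\<close> carries a
      factor \<open>t\<close> but the error a factor \<open>t^2\<close>. After division by
      \<open>t\<close> the right-hand side tends to 0, whatever the sign of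
      \<open>k\<close>.\<close>
    ultimately have "t * (g x - g z) \<le> t * (t * (k * (norm (z - x))\<^sup>2))"
      by (simp add: algebra_simps power2_eq_square)
    then show ?case
      using elim(2) by simp
  qed
  have "((\<lambda>t. t * (k * (norm (z - x))\<^sup>2)) \<longlongrightarrow> 0 * (k * (norm (z - x))\<^sup>2)) (at_right 0)"
    by (intro tendsto_intros)
  from tendsto_lowerbound[OF this ev] show ?thesis
    by simp
qed

lemma improvement_function_self:
  assumes "c x \<le> 0"
  shows "improvement_function f c \<rho> x x = 0"
  using assms by (simp add: improvement_function_def tau_def)

text \<open>Feasibility of \<open>x\<close> kills the penalty in \<open>tau\<close>, for any
  \<open>\<rho>\<close>, so the first entry of the maximum is \<open>f y - f x\<close>. That entry
  serves the feasible \<open>y\<close>, the entry \<open>c y\<close> the infeasible ones.\<close>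

lemma local_solution_improvement_function_nonneg:
  assumes "local_solution X f c x"
  obtains U where "open U" "x \<in> U"
    "\<And>y. y \<in> X \<Longrightarrow> y \<in> U \<Longrightarrow> 0 \<le> improvement_function f c \<rho> y x"
proof -
  from assms obtain U where U: "open U" "x \<in> U"
    and min: "is_arg_min f (\<lambda>y. y \<in> X \<and> c y \<le> 0 \<and> y \<in> U) x"
    unfolding local_solution_def by blast
  have "0 \<le> improvement_function f c \<rho> y x" if "y \<in> X" "y \<in> U" for y
    using min that unfolding is_arg_min_linorder
    by (cases "c y \<le> 0") (auto simp: improvement_function_def tau_def le_max_iff_disj)
  with U show thesis
    by (rule that)
qed

theorem theorem3p1:
  fixes f c :: "real ^ 'n \<Rightarrow> real"
    and X :: "(real ^ 'n) set"
    and \<rho> :: real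
    and A :: "real ^ 'n \<Rightarrow> 'i set"
    and M :: "'i \<Rightarrow> real ^ 'n \<Rightarrow> real ^ 'n \<Rightarrow> real"
    and xbar :: "real ^ 'n"
  assumes "locally_lipschitz f" and "locally_lipschitz c"
    and "X \<noteq> {}" and "convex X" and "closed X"
    and "\<rho> \<ge> 0"
    and "is_model X (improvement_function f c \<rho>) A M"
    and "local_solution X f c xbar"
  shows "FM_critical X c (improvement_function f c \<rho>) A M xbar"
proof -
  let ?H = "improvement_function f c \<rho>"
  have x: "xbar \<in> X" "c xbar \<le> 0"
    using assms(8) by (auto simp: local_solution_def is_arg_min_def)
  obtain U where U: "open U" "xbar \<in> U"
    and nonneg: "\<And>y. y \<in> X \<Longrightarrow> y \<in> U \<Longrightarrow> 0 \<le> ?H y xbar"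
    using local_solution_improvement_function_nonneg[OF assms(8)] by metis
  obtain \<mu> where fin: "finite (A xbar)"
    and conv: "\<And>a. a \<in> A xbar \<Longrightarrow> convex_on UNIV (\<lambda>y. M a y xbar)"
    and upper: "\<And>y. y \<in> X \<Longrightarrow> ?H y xbar \<le> min_model A M y xbar + \<mu> / 2 * (norm (y - xbar))\<^sup>2"
    using assms(7) x(1) unfolding is_model_def by blast
  have "M a xbar xbar \<le> M a z xbar" if a: "a \<in> active_indices ?H A M xbar" and "z \<in> X" for a z
  proof (rule convex_on_minimum_if_local_up_to_quadratic[where g = "\<lambda>y. M a y xbar"])
    \<comment> \<open>Activity is what puts the piece at the value \<open>?H xbar xbar = 0\<close>,
      the lower bound of \<open>?H\<close> on \<open>X\<close> near \<open>xbar\<close>.\<close>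
    have aA: "a \<in> A xbar" and a0: "M a xbar xbar = 0"
      using a x(2) by (auto simp: active_indices_def improvement_function_self)
    show "convex_on X (\<lambda>y. M a y xbar)"
      using convex_on_subset[OF conv[OF aA]] \<open>convex X\<close> by simp
    fix y assume y: "y \<in> X" "y \<in> U"
    \<comment> \<open>The model is a minimum, so its upper estimate of \<open>?H\<close> passes to
      each single piece, although the model itself need not be convex.\<close>
    have "min_model A M y xbar \<le> M a y xbar"
      unfolding min_model_def using fin aA by simp
    then show "M a xbar xbar \<le> M a y xbar + \<mu> / 2 * (norm (y - xbar))\<^sup>2"
      using nonneg[OF y] upper[OF y(1)] a0 by linarith
  qed (use x U \<open>z \<in> X\<close> in auto)
  then show ?thesis
    using x by (auto simp: FM_critical_def M_critical_def is_arg_min_linorder)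
qed

end
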